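(* Let $R$ be a commutative ring with unity and let $m_1,m_2\ge1$ be integers. Let $\lambda_1:\mathbb N\times\mathbb Z\to R$ have triangular support of order $m_1$, let $\mu_1:\mathbb N\times\mathbb Z\to R$ have triangular support of order $m_2$, and put $$f_n(x)=\sum_{b=0}^{w_{m_1}(n)}\lambda_1(n,b)\,x^{n-m_1b},\qquad g_n(x)=\sum_{c=0}^{w_{m_2}(n)}\mu_1(n,c)\,x^{n-m_2c}\qquad(n\in\mathbb N).$$ Assume that there exist families $\lambda_3,\mu_3:\mathbb N\times\mathbb Z\to R$ with triangular support of orders $m_1$ and $m_2$ respectively such that, for all $n\ge0$, $$x^n=\sum_{b=0}^{w_{m_1}(n)}\lambda_3(n,b)\,f_{n-m_1b}(x),\qquad x^n=\sum_{c=0}^{w_{m_2}(n)}\mu_3(n,c)\,g_{n-m_2c}(x).$$ Then, for all $n\in\mathbb N$, $$f_n(x)=\sum_{r=0}^{n}g_r(x)\,Z(n;r),$$ where $$Z(n;r)=\sum_{\substack{0\le b\le w_{m_1}(n)\\ r\le n-m_1b\\ n-m_1b-r\equiv0\ (\mathrm{mod}\ m_2)}}\lambda_1(n,b)\;\mu_3\!\Bigl(n-m_1b,\ \frac{n-m_1b-r}{m_2}\Bigr).$$ In the particular case $m_1=m_2=m$, writing $r=n-mk$ with $0\le k\le w_m(n)$, one has $$Z(n;r)=\sum_{b=0}^{k}\lambda_1(n,b)\,\mu_3(n-mb,\,k-b).$$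
   Context: $\mathbb N=\{0,1,2,\dots\}$ and $w_m(n)=\lfloor n/m\rfloor$. A family $\lambda:\mathbb N\times\mathbb Z\to R$ has triangular support of order $m$ if $\lambda(n,k)=0$ whenever $k<0$ or $k>w_m(n)$. *)

theory Defs
  imports "HOL-Computational_Algebra.Polynomial" "HOL-Number_Theory.Cong"
begin

definition width :: "nat \<Rightarrow> nat \<Rightarrow> nat" where
  "width m n = n div m"

definition triangular_support :: "nat \<Rightarrow> (nat \<Rightarrow> int \<Rightarrow> 'a::zero) \<Rightarrow> bool" where
  "triangular_support m L \<longleftrightarrow> (\<forall>n k. k < 0 \<or> k > int (width m n) \<longrightarrow> L n k = 0)"

(* All subtractions and the division below are exact on the index set:
   m1 * b \<le> n, r \<le> n - m1 * b, and m2 divides n - m1 * b - r. *)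
definition connection_coeff ::
  "nat \<Rightarrow> nat \<Rightarrow> (nat \<Rightarrow> int \<Rightarrow> 'a::comm_ring_1) \<Rightarrow> (nat \<Rightarrow> int \<Rightarrow> 'a) \<Rightarrow> nat \<Rightarrow> nat \<Rightarrow> 'a" where
  "connection_coeff m1 m2 L1 M3 n r =
     (\<Sum>b | b \<le> width m1 n \<and> r \<le> n - m1 * b \<and> [n - m1 * b - r = 0] (mod m2).
        L1 n (int b) * M3 (n - m1 * b) (int ((n - m1 * b - r) div m2)))"

end

theory Submission imports Defs begin

text \<open>This is a change of basis through the monomials. Each power \<open>x^(n - m1*b)\<close>
  occurring in \<open>f n\<close> is replaced by its expansion in the \<open>g\<close>, whose
  indices descend from \<open>n - m1*b\<close> in steps of \<open>m2\<close>. Reindexing by the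
  target index \<open>r\<close> (\<open>sum_step_down_reindex\<close>) and swapping the two finite
  sums collects the coefficient of each \<open>g r\<close>, which is \<open>connection_coeff\<close>
  (\<open>sum_smult_connection_coeff\<close>). For equal orders both descents use the same step, so
  the side conditions collapse to \<open>b \<le> k\<close>
  (\<open>connection_coeff_same_order\<close>).\<close>

text \<open>The maps \<open>c \<mapsto> N - m*c\<close> and \<open>r \<mapsto> (N - r) div m\<close>
  are mutually inverse. Letting \<open>h\<close> see both indices lets a coefficient depend on
  \<open>c\<close> while its polynomial depends on \<open>r\<close>.\<close>

lemma sum_step_down_reindex:
  fixes m N :: nat and h :: "nat \<Rightarrow> nat \<Rightarrow> 'b::comm_monoid_add"
  assumes "m \<ge> 1"
  shows "(\<Sum>c=0..width m N. h c (N - m * c)) =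
    (\<Sum>r | r \<le> N \<and> [N - r = 0] (mod m). h ((N - r) div m) r)"
proof (rule sum.reindex_bij_witness[where i = "\<lambda>r. (N - r) div m" and j = "\<lambda>c. N - m * c"])
  fix c assume "c \<in> {0..width m N}"
  then have le: "m * c \<le> N"
    using assms by (simp add: width_def less_eq_div_iff_mult_less_eq mult.commute)
  then have sub: "N - (N - m * c) = m * c" by simp
  show "(N - (N - m * c)) div m = c" using sub assms by simp
  then show "h ((N - (N - m * c)) div m) (N - m * c) = h c (N - m * c)" by simp
  show "N - m * c \<in> {r. r \<le> N \<and> [N - r = 0] (mod m)}"
    using sub by (simp add: cong_0_iff)
next
  fix r assume r: "r \<in> {r. r \<le> N \<and> [N - r = 0] (mod m)}"
  then have "m * ((N - r) div m) = N - r" by (simp add: cong_0_iff)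
  then show "N - m * ((N - r) div m) = r" using r by simp
  show "(N - r) div m \<in> {0..width m N}" by (simp add: width_def div_le_mono)
qed

lemma smult_sum_right: "smult a (\<Sum>i\<in>A. p i) = (\<Sum>i\<in>A. smult a (p i))"
  by (induction A rule: infinite_finite_induct) (auto simp: smult_add_right)

lemma sum_smult_connection_coeff:
  fixes L1 M3 :: "nat \<Rightarrow> int \<Rightarrow> 'a::comm_ring_1" and g :: "nat \<Rightarrow> 'a poly"
  assumes "m2 \<ge> 1"
    and inv: "\<And>n. monom 1 n = (\<Sum>c=0..width m2 n. smult (M3 n (int c)) (g (n - m2 * c)))"
  shows "(\<Sum>b=0..width m1 n. monom (L1 n (int b)) (n - m1 * b)) =
    (\<Sum>r=0..n. smult (connection_coeff m1 m2 L1 M3 n r) (g r))"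
proof -
  let ?T = "\<lambda>b r. smult (L1 n (int b) * M3 (n - m1 * b) (int ((n - m1 * b - r) div m2))) (g r)"
  let ?P = "\<lambda>b r. r \<le> n - m1 * b \<and> [n - m1 * b - r = 0] (mod m2)"
  have "monom (L1 n (int b)) (n - m1 * b) = (\<Sum>r | r \<in> {0..n} \<and> ?P b r. ?T b r)" for b
  proof -
    have "monom (L1 n (int b)) (n - m1 * b) = smult (L1 n (int b)) (monom 1 (n - m1 * b))"
      by (simp add: smult_monom)
    also have "\<dots> = (\<Sum>r | ?P b r. ?T b r)"
      using sum_step_down_reindex[OF assms(1), where N = "n - m1 * b"
          and h = "\<lambda>c r. smult (M3 (n - m1 * b) (int c)) (g r)"]
      by (simp add: inv[of "n - m1 * b"] smult_sum_right)
    \<comment> \<open>The bound \<open>r \<le> n\<close> follows from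
      \<open>r \<le> n - m1*b\<close>; stating it gives an outer range independent of
      \<open>b\<close>, the shape \<open>sum.swap_restrict\<close> expects.\<close>
    also have "{r. ?P b r} = {r. r \<in> {0..n} \<and> ?P b r}" by auto
    finally show ?thesis .
  qed
  then have "(\<Sum>b=0..width m1 n. monom (L1 n (int b)) (n - m1 * b)) =
      (\<Sum>b=0..width m1 n. \<Sum>r | r \<in> {0..n} \<and> ?P b r. ?T b r)"
    by (simp only:)
  also have "\<dots> = (\<Sum>r=0..n. \<Sum>b | b \<in> {0..width m1 n} \<and> ?P b r. ?T b r)"
    by (rule sum.swap_restrict) simp_all
  finally show ?thesis by (simp add: connection_coeff_def smult_sum)
qed

text \<open>With \<open>r = n - m*k\<close> the remaining gap is \<open>m*(k - b)\<close>, so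
  divisibility is automatic, and \<open>r \<le> n - m*b\<close> amounts to
  \<open>b \<le> k\<close>.\<close>

lemma connection_coeff_same_order:
  assumes "m \<ge> 1" and "k \<le> width m n"
  shows "connection_coeff m m L1 M3 n (n - m * k) =
    (\<Sum>b=0..k. L1 n (int b) * M3 (n - m * b) (int k - int b))"
proof -
  have kn: "m * k \<le> n"
    using assms by (simp add: width_def less_eq_div_iff_mult_less_eq mult.commute)
  have diff: "n - m * b - (n - m * k) = m * (k - b)" if "b \<le> k" for b
    using kn that by (simp add: diff_mult_distrib2)
  have le_k: "b \<le> k" if "b \<le> width m n" "n - m * k \<le> n - m * b" for b
  proof -
    \<comment> \<open>Subtraction on \<open>nat\<close> truncates: if \<open>m*k = n\<close>, the
      inequality in \<open>that(2)\<close> is vacuous, and this bound alone yields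
      \<open>b \<le> k\<close>.\<close>
    have "m * b \<le> n"
      using assms(1) that(1) by (simp add: width_def less_eq_div_iff_mult_less_eq mult.commute)
    then have "m * b \<le> m * k" using that(2) kn by linarith
    then show ?thesis using assms(1) by simp
  qed
  have "{b. b \<le> width m n \<and> n - m * k \<le> n - m * b \<and>
      [n - m * b - (n - m * k) = 0] (mod m)} = {0..k}"
    using assms(2) le_k diff by (auto simp: cong_0_iff intro: diff_le_mono2)
  then show ?thesis
    using assms(1) unfolding connection_coeff_def
    \<comment> \<open>Deleting \<open>diff_diff_left\<close> keeps the nested difference in the form
      that \<open>diff\<close> rewrites.\<close>
    by (auto simp: diff of_nat_diff simp del: diff_diff_left intro!: sum.cong)
qed

theorem theorem2p9:
  fixes m1 m2 :: nat
    and lambda1 mu1 lambda3 mu3 :: "nat \<Rightarrow> int \<Rightarrow> 'a::comm_ring_1"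
    and f g :: "nat \<Rightarrow> 'a poly"
  assumes "m1 \<ge> 1" and "m2 \<ge> 1"
    and "triangular_support m1 lambda1"
    and "triangular_support m2 mu1"
    and "\<And>n. f n = (\<Sum>b=0..width m1 n. monom (lambda1 n (int b)) (n - m1 * b))"
    and "\<And>n. g n = (\<Sum>c=0..width m2 n. monom (mu1 n (int c)) (n - m2 * c))"
    and "triangular_support m1 lambda3"
    and "triangular_support m2 mu3"
    and "\<And>n. monom 1 n = (\<Sum>b=0..width m1 n. smult (lambda3 n (int b)) (f (n - m1 * b)))"
    and "\<And>n. monom 1 n = (\<Sum>c=0..width m2 n. smult (mu3 n (int c)) (g (n - m2 * c)))"
  shows "(\<forall>n. f n = (\<Sum>r=0..n. smult (connection_coeff m1 m2 lambda1 mu3 n r) (g r))) \<and>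
    (\<forall>m. m1 = m \<and> m2 = m \<longrightarrow>
      (\<forall>n k. k \<le> width m n \<longrightarrow>
        connection_coeff m1 m2 lambda1 mu3 n (n - m * k) =
          (\<Sum>b=0..k. lambda1 n (int b) * mu3 (n - m * b) (int k - int b))))"
  using sum_smult_connection_coeff[OF assms(2,10)] assms(1,5) connection_coeff_same_order
  by auto

end
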